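(* Let $p$ be a prime and let $F\colon\mathbb{F}_{p^n}\to\mathbb{F}_{p^m}$ be a bent function such that, for a fixed $\epsilon\in\{\pm1,\pm i\}$ and some integers $r_b$, $W_F(b,0)=\epsilon p^{n/2}\zeta_p^{r_b}$ for all $b\in\mathbb{F}_{p^m}^*$. Then $n$ is even, $m\le n/2$, and for any $a\in\mathbb{F}_{p^m}$: - If $\epsilon\in\{1,i\}$: $|F^{-1}(a)|=p^{n-m}+p^{n/2}-p^{n/2-m}(pk_a+1)$ for some integer $k_a$ with $0\le k_a\le\frac{p^m-1}{p-1}$. In particular, $|F^{-1}(a)|\ge p^{n-m}-\frac{p^m-1}{p-1}p^{n/2-m}$. - If $\epsilon\in\{-1,-i\}$: $|F^{-1}(a)|=p^{n-m}-p^{n/2}+p^{n/2-m}(pk_a+1)$ for some integer $k_a$ with $0\le k_a\le\frac{p^m-1}{p-1}$. In particular, $|F^{-1}(a)|\le p^{n-m}+\frac{p^m-1}{p-1}p^{n/2-m}$. Additionally, $k_0=|\{b\in\mathbb{F}_{p^m}^*: W_F(b,0)=p^{n/2}\epsilon\zeta_p\}|$.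
   Context: Let $\zeta_p=e^{2\pi i/p}$, $i^2=-1$, and let $\operatorname{Tr}$ denote the absolute trace to $\mathbb{F}_p$. The Walsh transform of $F\colon\mathbb{F}_{p^n}\to\mathbb{F}_{p^m}$ is $W_F(b,a)=\sum_{x\in\mathbb{F}_{p^n}}\zeta_p^{\operatorname{Tr}(bF(x))-\operatorname{Tr}(ax)}$. $F$ is bent if $|W_F(b,a)|=p^{n/2}$ for all $b\in\mathbb{F}_{p^m}^*$ and $a\in\mathbb{F}_{p^n}$; equivalently, $|\{x: F(x+a)-F(x)=c\}|=p^{n-m}$ for all $a\ne0$ and all $c$. *)

theory Defs
  imports
    Complex_Main
    "HOL-Library.Cardinality"
    "HOL-Computational_Algebra.Computational_Algebra"
    "HOL-Number_Theory.Cong"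
begin

(* A field with q elements is a type of class finite_field whose cardinality is q.  The parameters
   p and n below are determined by CARD('a) = p ^ n. *)

definition trace_elem :: "nat \<Rightarrow> nat \<Rightarrow> 'a :: finite_field \<Rightarrow> 'a" where
  "trace_elem p n x = (\<Sum>i<n. x ^ (p ^ i))"

(* The trace lies in the prime subfield, which is identified with the integers modulo p;
   abs_trace is the representative in {0..<p}. *)
definition abs_trace :: "nat \<Rightarrow> nat \<Rightarrow> 'a :: finite_field \<Rightarrow> int" where
  "abs_trace p n x = (THE t. 0 \<le> t \<and> t < int p \<and> of_int t = trace_elem p n x)"

lemma CHAR_eq_of_card:
  assumes "prime p" "CARD('a :: finite_field) = p ^ n"
  shows "CHAR('a) = p"
proof -
  have "CHAR('a) dvd p ^ n"
  proof -
    have "(\<Sum>x\<in>UNIV. x) = (\<Sum>x\<in>UNIV. x + (1 :: 'a))"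
      by (rule sum.reindex_bij_witness[of _ "\<lambda>x. x + 1" "\<lambda>x. x - 1"]) auto
    then have "of_nat CARD('a) = (0 :: 'a)" by (simp add: sum.distrib)
    then show ?thesis by (simp add: of_nat_eq_0_iff_char_dvd assms(2) del: of_nat_power)
  qed
  moreover have "prime CHAR('a)" by simp
  ultimately show ?thesis
    using assms(1) prime_dvd_power primes_dvd_imp_eq by blast
qed

lemma trace_elem_power:
  assumes "prime p" "CARD('a :: finite_field) = p ^ n"
  shows "trace_elem p n (x :: 'a) ^ p = trace_elem p n x"
proof -
  have char: "CHAR('a) = p" by (rule CHAR_eq_of_card[OF assms])
  have "trace_elem p n x ^ p = (\<Sum>i<n. (x ^ (p ^ i)) ^ p)"
    unfolding trace_elem_def by (rule freshmans_dream_sum) (use char assms in auto)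
  also have "\<dots> = (\<Sum>i<n. x ^ (p ^ Suc i))"
    by (simp add: power_mult [symmetric] mult.commute)
  also have "\<dots> = (\<Sum>i<Suc n. x ^ (p ^ i)) - x ^ (p ^ 0)"
    by (simp add: sum.lessThan_Suc_shift del: sum.lessThan_Suc)
  also have "\<dots> = trace_elem p n x"
    using finite_field_power_card_eq_same[of x] assms(2)
    by (simp add: trace_elem_def)
  finally show ?thesis .
qed

lemma fixed_by_frobenius_imp_of_int:
  fixes y :: "'a :: finite_field"
  assumes "prime p" "CHAR('a) = p" "y ^ p = y"
  shows "\<exists>t. 0 \<le> t \<and> t < int p \<and> of_int t = y"
proof -
  define P :: "'a poly" where "P = monom 1 p - monom 1 1"
  have p: "p > 1" using assms(1) prime_gt_1_nat by blast
  have "coeff P p = 1" using p by (simp add: P_def)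
  then have nz: "P \<noteq> 0" by auto
  have "degree P \<le> p"
    unfolding P_def by (intro degree_diff_le order.trans[OF degree_monom_le]) (use p in auto)
  then have card: "card {z. poly P z = 0} \<le> p"
    using card_poly_roots_bound[OF nz] by simp
  have root: "poly P z = 0 \<longleftrightarrow> z ^ p = z" for z
    by (simp add: P_def poly_monom)
  have of_nat_root: "(of_nat k :: 'a) ^ p = of_nat k" for k
  proof (induction k)
    case 0
    then show ?case using p by simp
  next
    case (Suc k)
    have "((1 :: 'a) + of_nat k) ^ p = 1 ^ p + of_nat k ^ p"
      by (rule freshmans_dream) (use assms in auto)
    with Suc show ?case by simp
  qed
  have inj: "inj_on (of_nat :: nat \<Rightarrow> 'a) {..<p}"
    by (rule inj_onI) (simp add: of_nat_eq_iff_cong_CHAR assms(2) cong_less_modulus_unique_nat)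
  have "(of_nat ` {..<p} :: 'a set) = {z. poly P z = 0}"
  proof (rule card_seteq)
    show "finite {z. poly P z = 0}" by simp
    show "of_nat ` {..<p} \<subseteq> {z. poly P z = 0}" using of_nat_root root by auto
    show "card {z. poly P z = 0} \<le> card (of_nat ` {..<p} :: 'a set)"
      using card card_image[OF inj] by simp
  qed
  then obtain k where "k < p" "y = of_nat k" using assms(3) root by auto
  then show ?thesis by (intro exI[of _ "int k"]) auto
qed

lemma abs_trace_well_defined:
  assumes "prime p" "CARD('a :: finite_field) = p ^ n"
  shows "\<exists>!t. 0 \<le> t \<and> t < int p \<and> of_int t = trace_elem p n (x :: 'a)"
proof -
  have char: "CHAR('a) = p" by (rule CHAR_eq_of_card[OF assms])
  have "s = t" if "0 \<le> s" "s < int p" "0 \<le> t" "t < int p" "(of_int s :: 'a) = of_int t" for s t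
    using that char of_int_eq_iff_cong_CHAR[of s t, where ?'a = 'a]
    by (simp add: cong_less_imp_eq_int)
  with fixed_by_frobenius_imp_of_int[OF assms(1) char trace_elem_power[OF assms]]
  show ?thesis by (metis (no_types, lifting))
qed

definition zeta :: "nat \<Rightarrow> complex" where
  "zeta p = exp (2 * of_real pi * \<i> / of_nat p)"

definition walsh ::
    "nat \<Rightarrow> nat \<Rightarrow> nat \<Rightarrow> ('a :: finite_field \<Rightarrow> 'b :: finite_field) \<Rightarrow> 'b \<Rightarrow> 'a \<Rightarrow> complex" where
  "walsh p n m F b a =
     (\<Sum>x\<in>UNIV. zeta p powi (abs_trace p m (b * F x) - abs_trace p n (a * x)))"

definition bent ::
    "nat \<Rightarrow> nat \<Rightarrow> nat \<Rightarrow> ('a :: finite_field \<Rightarrow> 'b :: finite_field) \<Rightarrow> bool" where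
  "bent p n m F \<longleftrightarrow>
     (\<forall>b a. b \<noteq> 0 \<longrightarrow> cmod (walsh p n m F b a) = real p powr (real n / 2))"

end

theory Submission
  imports Defs
begin

text \<open>
  Conjugating \<open>\<zeta> \<mapsto> \<zeta>\<^sup>c\<close> sends \<open>W\<^sub>F(b,0)\<close> to \<open>W\<^sub>F(cb,0)\<close>.  The number \<open>E = \<epsilon> p\<^bsup>n/2\<^esup>\<close> is
  \<open>W\<^sub>F(1,0)\<close> times a \<open>p\<close>-th root of unity, and \<open>E\<^sup>2 = \<plusminus>p\<^sup>n\<close>, so every conjugate of \<open>E\<close> is \<open>\<plusminus>E\<close>;
  by hypothesis it is also \<open>E\<close> times a \<open>p\<close>-th root of unity.  For odd \<open>p\<close> this makes \<open>E\<close> invariant under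
  conjugation, and for \<open>p = 2\<close> there is nothing to conjugate.  Hence \<open>E\<close> is rational, so \<open>n\<close> is even
  and \<open>\<epsilon> = \<plusminus>1\<close>.

  Fourier inversion now gives \<open>p\<^sup>m |F\<^sup>-\<^sup>1(a)| = p\<^sup>n + \<epsilon> p\<^bsup>n/2\<^esup> S\<close>, where \<open>S\<close> is the sum of
  \<open>p\<^sup>m - 1\<close> \<open>p\<close>-th roots of unity.  As \<open>S\<close> is rational, the roots different from \<open>1\<close> all occur equally often,
  say \<open>k\<close> times, and \<open>S = p\<^sup>m - 1 - p k\<close>.  Divisibility by \<open>p\<^sup>m\<close> forces \<open>m \<le> n/2\<close>.
\<close>

subsection \<open>Conjugates of a primitive root of unity of prime order\<close>

text \<open>At the least index \<open>k\<close> with \<open>coeff g k\<close> not divisible by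
  \<open>q\<close>, the coefficient of \<open>f\<close> is \<open>coeff g k * coeff h 0\<close>
  modulo \<open>q\<close>, hence nonzero. Only the leading coefficient of \<open>f\<close> allows
  this, so \<open>g\<close> already has the full degree.\<close>

lemma prime_dvd_factor_coeff_imp_degree_0:
  fixes f g h :: "int poly"
  assumes q: "prime q" and fgh: "f = g * h" and lead: "\<not> q dvd lead_coeff f"
    and low: "\<And>k. k < degree f \<Longrightarrow> q dvd coeff f k"
    and g0: "q dvd coeff g 0" and h0: "\<not> q dvd coeff h 0"
  shows "degree h = 0"
proof -
  have "f \<noteq> 0" using lead by auto
  then have deg: "degree f = degree g + degree h"
    by (simp add: fgh degree_mult_eq)
  have ex: "\<not> q dvd coeff g (degree g)"
    using lead by (auto simp: fgh lead_coeff_mult)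
  define k where "k = (LEAST k. \<not> q dvd coeff g k)"
  have k: "\<not> q dvd coeff g k" unfolding k_def using ex by (rule LeastI)
  have below: "q dvd coeff g i" if "i < k" for i
    using that not_less_Least unfolding k_def by blast
  have "k \<le> degree g" unfolding k_def using ex by (rule Least_le)
  have split: "coeff f k = (\<Sum>i<k. coeff g i * coeff h (k - i)) + coeff g k * coeff h 0"
    by (simp add: fgh coeff_mult lessThan_Suc_atMost[symmetric])
  have "q dvd (\<Sum>i<k. coeff g i * coeff h (k - i))"
    by (intro dvd_sum dvd_mult2) (use below in auto)
  moreover have "\<not> q dvd coeff g k * coeff h 0"
    using k h0 q by (simp add: prime_dvd_mult_iff)
  ultimately have "\<not> q dvd coeff f k"
    unfolding split by (simp add: dvd_add_right_iff)
  then have "degree f \<le> k" using low not_less by blast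
  with deg \<open>k \<le> degree g\<close> show ?thesis by simp
qed

text \<open>Since \<open>q\<close> divides the constant term of \<open>f\<close> but its square does
  not, exactly one factor has constant term divisible by \<open>q\<close>, and the other is then
  constant. Monicity makes that constant a unit of the integers.\<close>

theorem eisenstein_irreducible:
  fixes f :: "int poly"
  assumes q: "prime q" and monic: "lead_coeff f = 1" and deg: "degree f > 0"
    and low: "\<And>k. k < degree f \<Longrightarrow> q dvd coeff f k"
    and f0: "\<not> q\<^sup>2 dvd coeff f 0"
  shows "irreducible f"
proof (rule irreducibleI)
  show "f \<noteq> 0" using deg by auto
  show "\<not> f dvd 1" using deg by (auto elim!: is_unit_polyE)
  fix g h assume fgh: "f = g * h"
  have lc: "lead_coeff g * lead_coeff h = 1"
    using monic by (simp add: fgh lead_coeff_mult)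
  have unit: "u dvd 1" if "degree u = 0" "lead_coeff u dvd 1" for u :: "int poly"
    using that by (elim degree_eq_zeroE) (simp add: is_unit_const_poly_iff)
  have lead: "\<not> q dvd lead_coeff f"
    using monic prime_gt_1_int[OF q] by simp
  have "q dvd coeff g 0 * coeff h 0"
    using low[OF deg] by (simp add: fgh coeff_mult_0)
  moreover have "\<not> (q dvd coeff g 0 \<and> q dvd coeff h 0)"
    using f0 by (auto simp: fgh coeff_mult_0 power2_eq_square intro: mult_dvd_mono)
  ultimately have "degree h = 0 \<or> degree g = 0"
    using prime_dvd_factor_coeff_imp_degree_0[OF q fgh lead low]
      prime_dvd_factor_coeff_imp_degree_0[OF q fgh[unfolded mult.commute[of g]] lead low] q
    by (metis prime_dvd_mult_iff)
  moreover have "lead_coeff g dvd 1" "lead_coeff h dvd 1"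
    using lc dvd_triv_left dvd_triv_right by metis+
  ultimately show "g dvd 1 \<or> h dvd 1"
    using unit by blast
qed

section \<open>Integer polynomials at complex numbers and divisibility by a minimal
  polynomial\<close>

abbreviation ipoly :: "int poly \<Rightarrow> complex \<Rightarrow> complex" where
  "ipoly f z \<equiv> poly (map_poly of_int f) z"

lemma ipoly_pCons [simp]: "ipoly (pCons a f) z = of_int a + z * ipoly f z"
  by (simp add: map_poly_pCons)

lemma ipoly_add [simp]: "ipoly (f + g) z = ipoly f z + ipoly g z"
proof -
  have "map_poly of_int (f + g) = (map_poly of_int f + map_poly of_int g :: complex poly)"
    by (rule poly_eqI) (simp add: coeff_map_poly)
  then show ?thesis by simp
qed

lemma ipoly_smult [simp]: "ipoly (smult a f) z = of_int a * ipoly f z"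
  by (simp add: map_poly_smult)

lemma ipoly_diff [simp]: "ipoly (f - g) z = ipoly f z - ipoly g z"
proof -
  have "map_poly of_int (f - g) = (map_poly of_int f - map_poly of_int g :: complex poly)"
    by (rule poly_eqI) (simp add: coeff_map_poly)
  then show ?thesis by simp
qed

lemma ipoly_mult [simp]: "ipoly (f * g) z = ipoly f z * ipoly g z"
  by (induction f) (simp_all add: algebra_simps)

lemma ipoly_sum [simp]: "ipoly (sum f A) z = (\<Sum>x\<in>A. ipoly (f x) z)"
  by (induction A rule: infinite_finite_induct) simp_all

lemma ipoly_monom [simp]: "ipoly (monom a k) z = of_int a * z ^ k"
  by (simp add: map_poly_monom poly_monom)

lemma ipoly_pcompose [simp]: "ipoly (pcompose f g) z = ipoly f (ipoly g z)"
  by (induction f) (simp_all add: pcompose_pCons)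

text \<open>\<open>P\<close> is the minimal polynomial of \<open>z\<close>: comparing it with an
  annihilator of least degree shows that no nonzero integer polynomial of smaller degree vanishes at
  \<open>z\<close>. Pseudo-division keeps the argument within integer coefficients.\<close>

lemma irreducible_ipoly_root_imp_dvd:
  fixes P f :: "int poly"
  assumes irr: "irreducible P" and monic: "lead_coeff P = 1"
    and root: "ipoly P z = 0" "ipoly f z = 0"
  shows "P dvd f"
proof -
  have prime: "prime_elem P" using irr by (rule irreducible_imp_prime_poly)
  have nz: "P \<noteq> 0" using monic by auto
  have min: "degree P \<le> degree g" if "g \<noteq> 0" "ipoly g z = 0" for g
  proof -
    from that obtain g where g: "g \<noteq> 0" "ipoly g z = 0"
      and least: "\<And>h. h \<noteq> 0 \<Longrightarrow> ipoly h z = 0 \<Longrightarrow> degree g \<le> degree h"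
      using ex_has_least_nat[of "\<lambda>g. g \<noteq> 0 \<and> ipoly g z = 0" g degree] by blast
    obtain a q where a: "a \<noteq> 0" "smult a P = g * q + pseudo_mod P g"
      using pseudo_mod(1)[OF g(1)] by blast
    have "ipoly (pseudo_mod P g) z = 0"
      using arg_cong[OF a(2), of "\<lambda>h. ipoly h z"] g(2) root(1) by simp
    then have "pseudo_mod P g = 0"
      using pseudo_mod(2)[OF g(1), of P] least[of "pseudo_mod P g"] by linarith
    then have eq: "smult a P = g * q" using a(2) by simp
    then have "P dvd g * q" by (metis dvd_smult dvd_refl)
    then consider "P dvd g" | "P dvd q" using prime prime_elem_dvd_mult_iff by blast
    then have "degree P \<le> degree g"
    proof cases
      case 1
      then show ?thesis using g(1) by (rule dvd_imp_degree_le)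
    next
      case 2
      then obtain s where "q = P * s" by (rule dvdE)
      then have "P * [:a:] = P * (g * s)" using eq by (simp add: mult_ac)
      \<comment> \<open>Cancelling \<open>P\<close> makes \<open>g\<close> a divisor of a nonzero
        constant, hence constant itself; but a nonzero constant has no root
        \<open>z\<close>.\<close>
      then have "[:a:] = g * s" using nz mult_left_cancel by blast
      then have "degree g = 0" using a(1)
        by (metis degree_mult_eq degree_pCons_0 add_is_0 mult_eq_0_iff pCons_eq_0_iff)
      then obtain b where "g = [:b:]" by (rule degree_eq_zeroE)
      then show ?thesis using g by simp
    qed
    then show ?thesis using least that by fastforce
  qed
  obtain q r where qr: "pseudo_divmod f P = (q, r)" by (cases "pseudo_divmod f P")
  \<comment> \<open>The scaling factor of the pseudo-division is a power of the leading coefficient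
    of \<open>P\<close>, hence 1.\<close>
  have eq: "f = P * q + r" and deg: "r = 0 \<or> degree r < degree P"
    using pseudo_divmod[OF nz qr] monic by simp_all
  have "ipoly r z = 0" using arg_cong[OF eq, of "\<lambda>h. ipoly h z"] root by simp
  then have "r = 0" using min[of r] deg by linarith
  then show ?thesis using eq by simp
qed

text \<open>All nontrivial \<open>p\<close>-th roots of unity, shifted by 1, are roots of one
  polynomial that is irreducible by Eisenstein at \<open>p\<close>, so they satisfy the same integer
  relations. This stands in for the Galois action on the cyclotomic field.\<close>

lemma prime_root_of_unity_conjugate:
  fixes f :: "int poly"
  assumes p: "prime p" and z: "z ^ p = 1" "z \<noteq> 1" and w: "w ^ p = 1" "w \<noteq> 1"
    and f: "ipoly f z = 0"
  shows "ipoly f w = 0"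
proof -
  \<comment> \<open>\<open>P\<close> is the cyclotomic polynomial shifted by one, \<open>((1 + X) ^ p - 1) / X\<close>.\<close>
  define P :: "int poly" where "P = (\<Sum>k<p. monom (int (p choose Suc k)) k)"
  have p1: "p > 1" using p by (rule prime_gt_1_nat)
  have coeff: "coeff P k = (if k < p then int (p choose Suc k) else 0)" for k
    by (simp add: P_def coeff_sum)
  have degP: "degree P = p - 1"
  proof (rule antisym)
    show "degree P \<le> p - 1" by (rule degree_le) (use p1 coeff in auto)
    show "p - 1 \<le> degree P" by (rule le_degree) (use p1 coeff in simp)
  qed
  have monic: "lead_coeff P = 1" using p1 by (simp add: degP coeff)
  have "irreducible P"
  proof (rule eisenstein_irreducible[of "int p"])
    show "prime (int p)" using p by simp
    show "lead_coeff P = 1" by (rule monic)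
    show "degree P > 0" using p1 degP by simp
    show "int p dvd coeff P k" if "k < degree P" for k
      using that degP p1 dvd_choose_prime[of "Suc k" p] p by (simp add: coeff)
    show "\<not> (int p)\<^sup>2 dvd coeff P 0"
      using p1 by (auto simp: coeff power2_eq_square dest: zdvd_imp_le)
  qed
  have root: "ipoly P (u - 1) = 0" if u: "u ^ p = 1" "u \<noteq> 1" for u
  proof -
    have "u ^ p = (\<Sum>k\<le>p. of_nat (p choose k) * (u - 1) ^ k)"
      using binomial_ring[of "u - 1" 1 p] by simp
    also have "\<dots> = 1 + (\<Sum>k<p. of_nat (p choose Suc k) * (u - 1) ^ Suc k)"
      by (simp add: lessThan_Suc_atMost[symmetric] sum.lessThan_Suc_shift del: sum.lessThan_Suc)
    also have "\<dots> = 1 + (u - 1) * ipoly P (u - 1)"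
      by (simp add: P_def sum_distrib_left mult_ac)
    finally show ?thesis using u by simp
  qed
  have "ipoly (pcompose f [:1, 1:]) (z - 1) = 0" using f by simp
  then have "P dvd pcompose f [:1, 1:]"
    using irreducible_ipoly_root_imp_dvd[OF \<open>irreducible P\<close> monic root[OF z]] by blast
  then obtain s where "pcompose f [:1, 1:] = P * s" by (rule dvdE)
  then have "ipoly (pcompose f [:1, 1:]) (w - 1) = 0" using root[OF w] by simp
  then show ?thesis by simp
qed

subsection \<open>Integral sums of roots of unity\<close>

lemma zeta_conv_cis: "zeta p = cis (2 * pi / real p)"
  by (simp add: zeta_def cis_conv_exp mult_ac)

lemma zeta_nonzero [simp]: "zeta p \<noteq> 0"
  by (simp add: zeta_def)

lemma zeta_powi_eq_1_iff:
  assumes "p > 0"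
  shows "zeta p powi j = 1 \<longleftrightarrow> int p dvd j"
proof -
  have "zeta p powi j = cis (of_int j * (2 * pi / real p))"
    by (simp add: zeta_conv_cis cis_power_int)
  also have "\<dots> = 1 \<longleftrightarrow> cos (of_int j * (2 * pi / real p)) = 1"
    using sin_cos_squared_add[of "of_int j * (2 * pi / real p)"]
    by (auto simp: complex_eq_iff simp del: sin_cos_squared_add)
  also have "\<dots> \<longleftrightarrow> (\<exists>i::int. of_int j * (2 * pi / real p) = of_int i * 2 * pi)"
    by (rule cos_one_2pi_int)
  also have "\<dots> \<longleftrightarrow> (\<exists>i. j = int p * i)"
  proof -
    have "of_int j * (2 * pi / real p) = of_int i * 2 * pi \<longleftrightarrow> real_of_int j = of_int (int p * i)" for i
      using assms by (simp add: field_simps)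
    then show ?thesis by (simp only: of_int_eq_iff)
  qed
  finally show ?thesis by (simp add: dvd_def)
qed

lemma zeta_powi_eq_iff:
  assumes "p > 0"
  shows "zeta p powi i = zeta p powi j \<longleftrightarrow> [i = j] (mod int p)"
proof -
  have "zeta p powi i = zeta p powi j \<longleftrightarrow> zeta p powi (i - j) = 1"
    by (simp add: power_int_diff)
  then show ?thesis
    using zeta_powi_eq_1_iff[OF assms] by (simp add: cong_iff_dvd_diff)
qed

lemma sum_zeta_powers:
  assumes "p > 0"
  shows "(\<Sum>c<p. zeta p powi (int c * j)) = (if int p dvd j then of_nat p else 0)"
proof -
  define w where "w = zeta p powi j"
  have eq: "zeta p powi (int c * j) = w ^ c" for c
    by (simp add: w_def power_int_mult mult.commute[of "int c"])
  have "w ^ p = 1"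
    using zeta_powi_eq_1_iff[OF assms, of "int p * j"] by (simp add: eq)
  moreover have "w = 1 \<longleftrightarrow> int p dvd j"
    unfolding w_def by (rule zeta_powi_eq_1_iff[OF assms])
  ultimately show ?thesis
    using geometric_sum[of w p] by (auto simp: eq)
qed

text \<open>The hypothesis is an integer polynomial relation for \<open>zeta p\<close>, which passes
  to its conjugate \<open>zeta p powi c\<close>. The factor \<open>d\<close> allows sums known only
  to be rational.\<close>

lemma conjugate_zeta_sum:
  fixes t :: "'x \<Rightarrow> int"
  assumes p: "prime p" and c: "\<not> int p dvd c"
    and sum: "of_int d * (\<Sum>x\<in>A. zeta p powi t x) = of_int q"
  shows "of_int d * (\<Sum>x\<in>A. zeta p powi (c * t x)) = of_int q"
proof -
  have p0: "p > 0" using p by (rule prime_gt_0_nat)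
  \<comment> \<open>Reducing the exponents modulo \<open>p\<close> makes them nonnegative without
    changing the powers of any \<open>p\<close>-th root of unity.\<close>
  define f :: "int poly" where
    "f = smult d (\<Sum>x\<in>A. monom 1 (nat (t x mod int p))) - [:q:]"
  have ipoly_f: "ipoly f (zeta p powi b) = of_int d * (\<Sum>x\<in>A. zeta p powi (b * t x)) - of_int q" for b
  proof -
    have "(zeta p powi b) ^ nat (t x mod int p) = zeta p powi (b * t x)" for x
    proof -
      have "(zeta p powi b) ^ nat (t x mod int p) = zeta p powi (b * (t x mod int p))"
        using p0 by (simp add: power_int_mult flip: power_int_of_nat)
      also have "\<dots> = zeta p powi (b * t x)"
        using p0 by (simp add: zeta_powi_eq_iff cong_def mod_mult_right_eq)
      finally show ?thesis .
    qed
    then show ?thesis by (simp add: f_def)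
  qed
  have root: "(zeta p powi b) ^ p = 1" "zeta p powi b \<noteq> 1" if "\<not> int p dvd b" for b
  proof -
    have "(zeta p powi b) ^ p = zeta p powi (b * int p)"
      by (simp add: power_int_mult)
    then show "(zeta p powi b) ^ p = 1" using zeta_powi_eq_1_iff[OF p0] by simp
    show "zeta p powi b \<noteq> 1" using zeta_powi_eq_1_iff[OF p0] that by simp
  qed
  have "ipoly f (zeta p powi 1) = 0"
    unfolding ipoly_f using sum by simp
  moreover have "\<not> int p dvd 1" using prime_gt_1_nat[OF p] by simp
  ultimately have "ipoly f (zeta p powi c) = 0"
    using prime_root_of_unity_conjugate[OF p root root[OF c]] by blast
  then show ?thesis by (simp add: ipoly_f)
qed

text \<open>The class of \<open>i\<close> is detected by averaging
  \<open>zeta p powi (c * (t x - i))\<close> over \<open>c\<close>. The term \<open>c = 0\<close>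
  gives \<open>card A\<close>; for every other \<open>c\<close> conjugation yields the same rational
  sum, so all nonzero classes have equal size.\<close>

lemma residue_class_count:
  fixes t :: "'x \<Rightarrow> int"
  assumes p: "prime p" and fin: "finite A"
    and sum: "of_int d * (\<Sum>x\<in>A. zeta p powi t x) = (of_int q :: complex)"
  shows "d * (int p * int (card {x\<in>A. [t x = i] (mod int p)})) =
           d * int (card A) + q * ((if int p dvd i then int p else 0) - 1)"
proof -
  have p0: "p > 0" using p by (rule prime_gt_0_nat)
  have lessThan: "{..<p} = insert 0 {1..<p}" using p0 by auto
  have split: "zeta p powi (int c * (t x - i)) =
      zeta p powi (int c * t x) * zeta p powi (int c * (- i))" for c x
    by (simp add: algebra_simps flip: power_int_add)
  have "of_int d * (of_nat p * of_nat (card {x\<in>A. [t x = i] (mod int p)})) =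
      of_int d * (\<Sum>x\<in>A. if int p dvd t x - i then of_nat p else (0 :: complex))"
    using fin by (simp add: sum.If_cases cong_iff_dvd_diff Int_def mult_ac)
  also have "\<dots> = of_int d * (\<Sum>x\<in>A. \<Sum>c<p. zeta p powi (int c * (t x - i)))"
    by (simp add: sum_zeta_powers[OF p0])
  also have "\<dots> = (\<Sum>c<p. zeta p powi (int c * (- i)) * (of_int d * (\<Sum>x\<in>A. zeta p powi (int c * t x))))"
    by (subst sum.swap) (simp only: split sum_distrib_left sum_distrib_right mult_ac)
  also have "\<dots> = of_int d * of_nat (card A) +
      (\<Sum>c\<in>{1..<p}. zeta p powi (int c * (- i)) * (of_int d * (\<Sum>x\<in>A. zeta p powi (int c * t x))))"
    unfolding lessThan by (subst sum.insert) auto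
  also have "(\<Sum>c\<in>{1..<p}. zeta p powi (int c * (- i)) * (of_int d * (\<Sum>x\<in>A. zeta p powi (int c * t x)))) =
      (\<Sum>c\<in>{1..<p}. zeta p powi (int c * (- i)) * of_int q)"
  proof (intro sum.cong refl)
    fix c assume "c \<in> {1..<p}"
    then have "\<not> int p dvd int c" by (auto dest: dvd_imp_le)
    from conjugate_zeta_sum[OF p this sum]
    show "zeta p powi (int c * (- i)) * (of_int d * (\<Sum>x\<in>A. zeta p powi (int c * t x))) =
        zeta p powi (int c * (- i)) * of_int q" by simp
  qed
  \<comment> \<open>The missing term \<open>c = 0\<close>, equal to 1, is added and subtracted to
    complete the geometric sum.\<close>
  also have "\<dots> = ((\<Sum>c<p. zeta p powi (int c * (- i))) - 1) * of_int q"
    unfolding lessThan by (subst sum.insert) (auto simp: sum_distrib_right)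
  also have "\<dots> = ((if int p dvd i then of_nat p else 0) - 1) * of_int q"
    by (subst sum_zeta_powers[OF p0]) simp
  finally have "(of_int (d * (int p * int (card {x\<in>A. [t x = i] (mod int p)}))) :: complex) =
      of_int (d * int (card A) + q * ((if int p dvd i then int p else 0) - 1))"
    by (auto simp: algebra_simps)
  then show ?thesis by (simp only: of_int_eq_iff)
qed

subsection \<open>The trace character\<close>

lemma trace_elem_add:
  fixes x y :: "'a :: finite_field"
  assumes "prime p" "CARD('a) = p ^ n"
  shows "trace_elem p n (x + y) = trace_elem p n x + trace_elem p n y"
proof -
  have "(x + y) ^ (p ^ i) = x ^ (p ^ i) + y ^ (p ^ i)" for i
    by (rule freshmans_dream') (use CHAR_eq_of_card[OF assms] assms in auto)
  then show ?thesis by (simp add: trace_elem_def sum.distrib)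
qed

text \<open>The trace is a nonzero polynomial of degree at most \<open>p ^ (n - 1)\<close>, too few
  roots to vanish on \<open>p ^ n\<close> elements.\<close>

lemma exists_trace_elem_nonzero:
  assumes p: "prime p" and card: "CARD('a :: finite_field) = p ^ n"
  shows "\<exists>x :: 'a. trace_elem p n x \<noteq> 0"
proof -
  have p1: "p > 1" using p by (rule prime_gt_1_nat)
  have "card {0, 1 :: 'a} \<le> CARD('a)" by (rule card_mono) auto
  then have "n \<noteq> 0" using card by (intro notI) simp
  then have n: "n > 0" by simp
  define P :: "'a poly" where "P = (\<Sum>i<n. monom 1 (p ^ i))"
  have "coeff P (p ^ 0) = (\<Sum>i<n. if i = 0 then 1 else 0)"
    unfolding P_def coeff_sum coeff_monom
    by (intro sum.cong refl) (use p1 in \<open>auto simp: power_eq_1_iff\<close>)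
  then have nz: "P \<noteq> 0" using n by auto
  have "degree P \<le> p ^ (n - 1)"
    unfolding P_def
    by (intro degree_sum_le order.trans[OF degree_monom_le] power_increasing) (use p1 n in auto)
  then have "card {x. poly P x = 0} \<le> p ^ (n - 1)"
    using card_poly_roots_bound[OF nz] by linarith
  also have "\<dots> < CARD('a)"
    unfolding card by (intro power_strict_increasing) (use p1 n in auto)
  finally have "{x. poly P x = 0} \<noteq> UNIV" by auto
  then show ?thesis
    by (auto simp: P_def poly_sum poly_monom trace_elem_def)
qed

lemma of_int_abs_trace:
  assumes "prime p" "CARD('a :: finite_field) = p ^ n"
  shows "of_int (abs_trace p n x) = trace_elem p n (x :: 'a)"
  using theI'[OF abs_trace_well_defined[OF assms, of x]] unfolding abs_trace_def by blast

text \<open>The canonical additive character of the field.\<close>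

definition trace_char :: "nat \<Rightarrow> nat \<Rightarrow> 'a :: finite_field \<Rightarrow> complex" where
  "trace_char p n x = zeta p powi abs_trace p n x"

context
  fixes p n :: nat
  assumes p: "prime p" and card: "CARD('a :: finite_field) = p ^ n"
begin

lemma abs_trace_cong_iff:
  fixes x :: 'a
  shows "[abs_trace p n x = j] (mod int p) \<longleftrightarrow> trace_elem p n x = of_int j"
  using of_int_eq_iff_cong_CHAR[of "abs_trace p n x" j, where ?'a = 'a]
  by (simp add: of_int_abs_trace[OF p card] CHAR_eq_of_card[OF p card])

lemma trace_char_eq_1_iff:
  fixes x :: 'a
  shows "trace_char p n x = 1 \<longleftrightarrow> trace_elem p n x = 0"
  using zeta_powi_eq_iff[OF prime_gt_0_nat[OF p], of "abs_trace p n x" 0]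
  by (simp add: trace_char_def abs_trace_cong_iff)

lemma trace_char_add:
  fixes x y :: 'a
  shows "trace_char p n (x + y) = trace_char p n x * trace_char p n y"
proof -
  have "[abs_trace p n (x + y) = abs_trace p n x + abs_trace p n y] (mod int p)"
    by (simp add: abs_trace_cong_iff of_int_abs_trace[OF p card] trace_elem_add[OF p card])
  then have "trace_char p n (x + y) = zeta p powi (abs_trace p n x + abs_trace p n y)"
    unfolding trace_char_def by (simp add: zeta_powi_eq_iff[OF prime_gt_0_nat[OF p]])
  then show ?thesis by (simp add: trace_char_def power_int_add)
qed

lemma abs_trace_0 [simp]: "abs_trace p n (0 :: 'a) = 0"
  unfolding abs_trace_def
proof (rule the1_equality[OF abs_trace_well_defined[OF p card]])
  show "0 \<le> (0 :: int) \<and> 0 < int p \<and> of_int 0 = trace_elem p n (0 :: 'a)"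
    using prime_gt_0_nat[OF p] by (simp add: trace_elem_def zero_power)
qed

lemma trace_char_0 [simp]: "trace_char p n (0 :: 'a) = 1"
  by (simp add: trace_char_def)

text \<open>This identifies conjugation of the values by \<open>c\<close> with the change from
  \<open>b\<close> to \<open>c * b\<close> in a Walsh coefficient.\<close>

lemma trace_char_of_nat_mult:
  fixes x :: 'a
  shows "trace_char p n (of_nat c * x) = trace_char p n x ^ c"
  by (induction c) (simp_all add: trace_char_add ring_distribs)

text \<open>For nonzero \<open>y\<close>, translating \<open>b\<close> by \<open>x / y\<close>
  multiplies the sum by \<open>trace_char p n x\<close>, which differs from 1 when \<open>x\<close>
  has nonzero trace. The sum therefore vanishes.\<close>

lemma sum_trace_char:
  fixes y :: 'a
  shows "(\<Sum>b\<in>UNIV. trace_char p n (b * y)) = (if y = 0 then of_nat (p ^ n) else 0)"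
proof (cases "y = 0")
  case True
  then show ?thesis by (simp add: card)
next
  case False
  obtain x :: 'a where x: "trace_elem p n x \<noteq> 0"
    using exists_trace_elem_nonzero[OF p card] by blast
  let ?S = "\<Sum>b\<in>UNIV. trace_char p n (b * y)"
  have "?S = (\<Sum>b\<in>UNIV. trace_char p n ((b + x / y) * y))"
    by (rule sum.reindex_bij_witness[of _ "\<lambda>b. b + x / y" "\<lambda>b. b - x / y"]) auto
  also have "\<dots> = ?S * trace_char p n x"
    using False by (simp add: ring_distribs trace_char_add sum_distrib_right)
  finally have "?S = 0"
    using x by (simp add: trace_char_eq_1_iff)
  then show ?thesis using False by simp
qed

end

subsection \<open>Walsh coefficients and preimage sizes\<close>

lemma walsh_0_right:
  fixes F :: "'a :: finite_field \<Rightarrow> 'b :: finite_field"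
  assumes "prime p" "CARD('a) = p ^ n"
  shows "walsh p n m F b 0 = (\<Sum>x\<in>UNIV. trace_char p m (b * F x))"
  using abs_trace_0[OF assms] by (simp add: walsh_def trace_char_def)

lemma walsh_inversion:
  fixes F :: "'a :: finite_field \<Rightarrow> 'b :: finite_field"
  assumes p: "prime p" and card_a: "CARD('a) = p ^ n" and card_b: "CARD('b) = p ^ m"
  shows "(\<Sum>b\<in>UNIV. walsh p n m F b 0 * trace_char p m (- (a * b))) =
           of_nat (p ^ m * card (F -` {a}))"
proof -
  have "trace_char p m (b * F x) * trace_char p m (- (a * b)) = trace_char p m (b * (F x - a))" for b x
    by (simp add: trace_char_add[OF p card_b, symmetric] algebra_simps)
  then have "(\<Sum>b\<in>UNIV. walsh p n m F b 0 * trace_char p m (- (a * b))) =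
      (\<Sum>b\<in>UNIV. \<Sum>x\<in>UNIV. trace_char p m (b * (F x - a)))"
    by (simp add: walsh_0_right[OF p card_a] sum_distrib_right)
  also have "\<dots> = (\<Sum>x\<in>UNIV. if F x = a then of_nat (p ^ m) else 0)"
    by (subst sum.swap) (simp add: sum_trace_char[OF p card_b])
  also have "\<dots> = of_nat (p ^ m * card (F -` {a}))"
    by (simp add: sum.If_cases vimage_def)
  finally show ?thesis .
qed

section \<open>Parity of the exponent and the value of \<epsilon>\<close>

text \<open>Each conjugate of \<open>E\<close> has the same square as \<open>E\<close> and differs
  from it by a \<open>p\<close>-th root of unity, which forces equality with \<open>E\<close>. The
  sum of the \<open>p - 1\<close> conjugates is then both \<open>(p - 1) * E\<close> and an
  integer.\<close>

lemma conjugate_sums_constant_imp_integer: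
  fixes t :: "'x \<Rightarrow> int" and E :: complex
  assumes p: "prime p" and fin: "finite A" and E: "E \<noteq> 0" "E\<^sup>2 = of_int q"
    and sum1: "(\<Sum>x\<in>A. zeta p powi t x) = E"
    and sums: "\<And>c. c \<in> {1..<p} \<Longrightarrow> \<exists>s. (\<Sum>x\<in>A. zeta p powi (int c * t x)) = E * zeta p powi s"
  shows "\<exists>j. of_nat (p - 1) * E = of_int j"
proof -
  have p0: "p > 0" using p by (rule prime_gt_0_nat)
  have square: "(\<Sum>x\<in>A. zeta p powi (c * t x))\<^sup>2 =
      (\<Sum>z\<in>A \<times> A. zeta p powi (c * (t (fst z) + t (snd z))))" for c
    by (simp add: power2_eq_square sum_product sum.cartesian_product case_prod_unfold
        ring_distribs power_int_add)
  have const: "(\<Sum>x\<in>A. zeta p powi (int c * t x)) = E" if c: "c \<in> {1..<p}" for c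
  proof -
    obtain s where s: "(\<Sum>x\<in>A. zeta p powi (int c * t x)) = E * zeta p powi s"
      using sums[OF c] by blast
    have pc: "\<not> int p dvd int c" using c by (auto dest: dvd_imp_le)
    \<comment> \<open>The square is itself a sum of roots of unity, indexed by pairs, with integer
      value \<open>q\<close>; conjugation therefore fixes it.\<close>
    have "of_int 1 * (\<Sum>z\<in>A \<times> A. zeta p powi (t (fst z) + t (snd z))) = (of_int q :: complex)"
      using square[of 1] sum1 E(2) by simp
    from conjugate_zeta_sum[OF p pc this] square[of "int c"]
    have "(E * zeta p powi s)\<^sup>2 = E\<^sup>2"
      using s E(2) by simp
    then have "(zeta p powi s)\<^sup>2 = 1"
      using E(1) by (simp add: power_mult_distrib)
    then have "zeta p powi (s * 2) = 1"
      by (simp add: power_int_mult)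
    then have "int p dvd s * 2"
      using zeta_powi_eq_1_iff[OF p0] by blast
    \<comment> \<open>For odd \<open>p\<close> the root of unity is 1; for \<open>p = 2\<close> the
      only index is \<open>c = 1\<close>.\<close>
    then consider "int p dvd s" | "int p dvd 2"
      using p prime_dvd_mult_iff[of "int p" s 2] by auto
    then show ?thesis
    proof cases
      case 1
      then show ?thesis using s zeta_powi_eq_1_iff[OF p0, of s] by simp
    next
      case 2
      then have "p \<le> 2" using zdvd_imp_le[of "int p" 2] by simp
      with c have "c = 1" by simp
      then show ?thesis using sum1 by simp
    qed
  qed
  have lessThan: "{..<p} = insert 0 {1..<p}" using p0 by auto
  have "(\<Sum>x\<in>A. if int p dvd t x then of_nat p else (0 :: complex)) =
      (\<Sum>c<p. \<Sum>x\<in>A. zeta p powi (int c * t x))"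
    by (subst sum.swap) (simp add: sum_zeta_powers[OF p0])
  also have "\<dots> = of_nat (card A) + of_nat (p - 1) * E"
    unfolding lessThan by (subst sum.insert) (auto simp: const)
  finally have "of_nat (p - 1) * E =
      of_int ((\<Sum>x\<in>A. if int p dvd t x then int p else 0) - int (card A))"
    by (simp add: if_distrib[of of_int] algebra_simps cong: if_cong)
  then show ?thesis by blast
qed

lemma of_real_powr_half_square:
  assumes "p > 0"
  shows "(of_real (real p powr (real n / 2)) :: complex)\<^sup>2 = of_nat p ^ n"
proof -
  have "(real p powr (real n / 2))\<^sup>2 = real p ^ n"
    using assms by (simp add: power2_eq_square powr_realpow flip: powr_add)
  then show ?thesis by (metis of_real_power of_real_of_nat_eq)
qed

text \<open>Squaring gives \<open>(p - 1)^2 * p ^ n\<close> up to the sign \<epsilon>^2. A negative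
  sign is impossible for an integer square, and comparing multiplicities of \<open>p\<close>, which
  does not divide \<open>p - 1\<close>, makes \<open>n\<close> even.\<close>

lemma even_exponent_if_integer_multiple:
  fixes \<epsilon> :: complex
  assumes p: "prime p" and eps: "\<epsilon> \<in> {1, -1, \<i>, -\<i>}"
    and j: "of_nat (p - 1) * (\<epsilon> * of_real (real p powr (real n / 2))) = of_int j"
  shows "even n \<and> \<epsilon> \<in> {1, -1}"
proof -
  have p1: "p > 1" using p by (rule prime_gt_1_nat)
  have sq: "(of_int j :: complex)\<^sup>2 = of_nat ((p - 1)\<^sup>2 * p ^ n) * \<epsilon>\<^sup>2"
    unfolding j[symmetric] using p1
    by (simp add: power_mult_distrib of_real_powr_half_square mult_ac)
  have eps1: "\<epsilon> \<in> {1, -1}"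
  proof (rule ccontr)
    assume "\<epsilon> \<notin> {1, -1}"
    then have "\<epsilon>\<^sup>2 = -1" using eps by auto
    then have "(of_int (j\<^sup>2) :: complex) = of_int (- int ((p - 1)\<^sup>2 * p ^ n))"
      using sq by simp
    then have "j\<^sup>2 = - int ((p - 1)\<^sup>2 * p ^ n)" by (simp only: of_int_eq_iff)
    moreover have "int ((p - 1)\<^sup>2 * p ^ n) > 0" using p1 by simp
    ultimately show False using zero_le_power2[of j] by linarith
  qed
  then have "\<epsilon>\<^sup>2 = 1" by auto
  then have "(of_int (j\<^sup>2) :: complex) = of_int (int ((p - 1)\<^sup>2 * p ^ n))"
    using sq by simp
  then have "j\<^sup>2 = int ((p - 1)\<^sup>2 * p ^ n)" by (simp only: of_int_eq_iff)
  then have eq: "(nat \<bar>j\<bar>)\<^sup>2 = (p - 1)\<^sup>2 * p ^ n"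
    by (simp add: nat_eq_iff flip: nat_power_eq)
  have "nat \<bar>j\<bar> \<noteq> 0" using eq p1 by (intro notI) simp
  moreover have "\<not> p dvd p - 1" using p1 by (auto dest: dvd_imp_le)
  ultimately have "2 * multiplicity p (nat \<bar>j\<bar>) = n"
    using arg_cong[OF eq, of "multiplicity p"] p p1
    by (simp add: prime_elem_multiplicity_mult_distrib prime_elem_multiplicity_power_distrib
        not_dvd_imp_multiplicity_0)
  then show ?thesis using eps1 by auto
qed

lemma walsh_0_even_exponent:
  fixes F :: "'a :: finite_field \<Rightarrow> 'b :: finite_field" and \<epsilon> :: complex and r :: "'b \<Rightarrow> int"
  assumes p: "prime p" and card_a: "CARD('a) = p ^ n" and card_b: "CARD('b) = p ^ m"
    and eps: "\<epsilon> \<in> {1, -1, \<i>, -\<i>}"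
    and walsh: "\<And>b. b \<noteq> 0 \<Longrightarrow>
      walsh p n m F b 0 = \<epsilon> * of_real (real p powr (real n / 2)) * zeta p powi r b"
  shows "even n \<and> \<epsilon> \<in> {1, -1}"
proof -
  have p1: "p > 1" using p by (rule prime_gt_1_nat)
  define E where "E = \<epsilon> * of_real (real p powr (real n / 2))"
  \<comment> \<open>Subtracting \<open>r 1\<close> removes the root of unity from the Walsh
    coefficient at 1, so that the sum is exactly \<open>E\<close>.\<close>
  define t where "t x = abs_trace p m (F x) - r 1" for x
  have E0: "E \<noteq> 0" using eps p1 by (auto simp: E_def)
  have "(of_real (real p powr (real n / 2)) :: complex)\<^sup>2 = of_nat p ^ n"
    using p1 by (simp add: of_real_powr_half_square)
  moreover have "\<epsilon>\<^sup>2 = of_int 1 \<or> \<epsilon>\<^sup>2 = of_int (-1)" using eps by auto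
  ultimately have "\<exists>q. E\<^sup>2 = of_int q"
    unfolding E_def power_mult_distrib by (metis of_int_mult of_int_of_nat_eq of_int_power)
  then obtain q where E2: "E\<^sup>2 = of_int q" ..
  have sum: "(\<Sum>x\<in>UNIV. zeta p powi (int c * t x)) = E * zeta p powi (r (of_nat c) - int c * r 1)"
    if c: "c \<in> {1..<p}" for c
  proof -
    have "(of_nat c :: 'b) \<noteq> 0"
      using c CHAR_eq_of_card[OF p card_b]
      by (auto simp: of_nat_eq_0_iff_char_dvd dest: dvd_imp_le)
    then have "E * zeta p powi r (of_nat c) = (\<Sum>x\<in>UNIV. trace_char p m (F x) ^ c)"
      using walsh[of "of_nat c"] unfolding walsh_0_right[OF p card_a] E_def
      by (simp add: trace_char_of_nat_mult[OF p card_b])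
    also have "\<dots> = (\<Sum>x\<in>UNIV. zeta p powi (int c * abs_trace p m (F x)))"
      by (simp add: trace_char_def power_int_mult mult.commute[of "int c"])
    finally show ?thesis
      by (simp add: t_def ring_distribs power_int_diff sum_divide_distrib[symmetric])
  qed
  have "\<exists>j. of_nat (p - 1) * E = of_int j"
  proof (rule conjugate_sums_constant_imp_integer[OF p finite_class.finite_UNIV E0 E2])
    show "(\<Sum>x\<in>UNIV. zeta p powi t x) = E" using sum[of 1] p1 by simp
  qed (use sum in blast)
  then show ?thesis
    using even_exponent_if_integer_multiple[OF p eps] unfolding E_def by blast
qed

section \<open>Preimage sizes from residue class counts\<close>

text \<open>Fourier inversion makes the sum of \<open>zeta p powi t b\<close> over nonzero
  \<open>b\<close> rational, so residue classes can be counted. The class of 1 represents all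
  nonzero classes; the class of 0 has the remaining \<open>p ^ m - 1 - (p - 1) * k\<close> elements,
  and its nonnegativity bounds \<open>k\<close>.\<close>

lemma preimage_count:
  fixes F :: "'a :: finite_field \<Rightarrow> 'b :: finite_field" and r :: "'b \<Rightarrow> int" and a :: 'b
  assumes p: "prime p" and card_a: "CARD('a) = p ^ (2 * h)" and card_b: "CARD('b) = p ^ m"
    and s: "s \<in> {1, -1}"
    and walsh: "\<And>b. b \<noteq> 0 \<Longrightarrow> walsh p (2 * h) m F b 0 = of_int (s * int p ^ h) * zeta p powi r b"
  defines "k \<equiv> int (card {b. b \<noteq> 0 \<and> [r b + abs_trace p m (- (a * b)) = 1] (mod int p)})"
  shows "int p ^ m * int (card (F -` {a})) = int p ^ (2 * h) + s * int p ^ h * (int p ^ m - 1 - int p * k)"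
    and "(int p - 1) * k \<le> int p ^ m - 1"
proof -
  have p1: "p > 1" using p by (rule prime_gt_1_nat)
  define A where "A = {b :: 'b. b \<noteq> 0}"
  define t where "t b = r b + abs_trace p m (- (a * b))" for b
  define d where "d = s * int p ^ h"
  \<comment> \<open>The inversion sum with its term at \<open>b = 0\<close>, equal to
    \<open>p ^ (2 * h)\<close>, removed.\<close>
  define q where "q = int p ^ m * int (card (F -` {a})) - int p ^ (2 * h)"
  define k0 where "k0 = int (card {b\<in>A. [t b = 0] (mod int p)})"
  have d: "d \<noteq> 0" using s p1 by (auto simp: d_def)
  have UNIV_eq: "(UNIV :: 'b set) = insert 0 A" by (auto simp: A_def)
  have fin: "finite A" and "0 \<notin> A" by (auto simp: A_def)
  then have "CARD('b) = Suc (card A)" unfolding UNIV_eq by simp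
  then have card_A: "int (card A) = int p ^ m - 1" unfolding card_b by (simp flip: of_nat_power)
  have walsh_0: "walsh p (2 * h) m F 0 0 = of_nat p ^ (2 * h)"
    using card_a by (simp add: walsh_0_right[OF p card_a] trace_char_0[OF p card_b])
  have "of_nat (p ^ m * card (F -` {a})) =
      of_nat p ^ (2 * h) + (\<Sum>b\<in>A. walsh p (2 * h) m F b 0 * trace_char p m (- (a * b)))"
    using \<open>0 \<notin> A\<close> fin unfolding walsh_inversion[OF p card_a card_b, symmetric] UNIV_eq
    by (simp add: walsh_0 trace_char_0[OF p card_b])
  also have "(\<Sum>b\<in>A. walsh p (2 * h) m F b 0 * trace_char p m (- (a * b))) =
      of_int d * (\<Sum>b\<in>A. zeta p powi t b)"
    unfolding sum_distrib_left
    by (intro sum.cong) (auto simp: A_def walsh d_def t_def trace_char_def power_int_add)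
  finally have sum: "of_int d * (\<Sum>b\<in>A. zeta p powi t b) = (of_int q :: complex)"
    by (simp add: q_def algebra_simps)
  have "\<not> int p dvd 1" using p1 by simp
  then have eq1: "d * (int p * k) = d * (int p ^ m - 1) - q"
    using residue_class_count[OF p fin sum, of 1]
    by (simp add: k_def A_def t_def card_A[unfolded A_def])
  have "d * (int p * k0) = d * (int p ^ m - 1) + q * (int p - 1)"
    using residue_class_count[OF p fin sum, of 0] by (simp add: k0_def card_A)
  also have "q = d * (int p ^ m - 1) - d * (int p * k)" using eq1 by simp
  finally have "(d * int p) * k0 = (d * int p) * (int p ^ m - 1 - (int p - 1) * k)"
    by (simp add: algebra_simps)
  then have "k0 = int p ^ m - 1 - (int p - 1) * k" using d p1 by simp
  moreover have "k0 \<ge> 0" by (simp add: k0_def)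
  ultimately show "(int p - 1) * k \<le> int p ^ m - 1" by simp
  show "int p ^ m * int (card (F -` {a})) = int p ^ (2 * h) + s * int p ^ h * (int p ^ m - 1 - int p * k)"
    using eq1 by (simp add: q_def d_def algebra_simps)
qed

text \<open>If \<open>m\<close> exceeded \<open>h\<close>, division by \<open>p ^ h\<close> would
  leave every term except \<open>s\<close> divisible by \<open>p\<close>, contradicting
  \<open>s = 1\<close> or \<open>s = -1\<close>.\<close>

lemma exponent_bound:
  fixes N k s :: int
  assumes p: "prime p" and h: "h > 0" and s: "s \<in> {1, -1}"
    and N: "int p ^ m * N = int p ^ (2 * h) + s * int p ^ h * (int p ^ m - 1 - int p * k)"
  shows "m \<le> h"
proof (rule ccontr)
  assume "\<not> m \<le> h"
  then obtain l where l: "m = h + Suc l" by (metis less_imp_Suc_add not_le add_Suc_right)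
  obtain g where g: "h = Suc g" using h by (cases h) auto
  have p1: "p > 1" using p by (rule prime_gt_1_nat)
  have "int p ^ h * (int p ^ Suc l * N) = int p ^ h * (int p ^ h + s * (int p ^ m - 1 - int p * k))"
    using N unfolding l mult_2 power_add by (simp add: algebra_simps)
  then have "int p ^ Suc l * N = int p ^ h + s * (int p ^ m - 1 - int p * k)"
    using p1 by simp
  then have "s = int p * (int p ^ g + s * int p ^ (h + l) - s * k - int p ^ l * N)"
    unfolding l by (simp add: g algebra_simps)
  then have "int p dvd s" by (rule dvdI)
  then show False using s p1 by auto
qed

text \<open>This is division by \<open>p ^ m\<close>; \<open>m \<le> h\<close> makes the natural
  number subtractions in the exponents genuine.\<close>

lemma exact_count_over_reals:
  fixes N k s :: int
  assumes p: "prime p" and mh: "m \<le> h"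
    and N: "int p ^ m * N = int p ^ (2 * h) + s * int p ^ h * (int p ^ m - 1 - int p * k)"
  shows "of_int N = real p ^ (2 * h - m) + of_int s * real p ^ h
           - of_int s * (real p ^ (h - m) * (real p * of_int k + 1))"
proof -
  have p0: "real p > 0" using prime_gt_0_nat[OF p] by simp
  obtain l where l: "h = m + l" using mh by (metis le_add_diff_inverse)
  have "real p ^ m * of_int N = of_int (int p ^ m * N)" by simp
  also have "\<dots> = real p ^ (2 * h) + of_int s * real p ^ h * (real p ^ m - 1 - real p * of_int k)"
    unfolding N by simp
  also have "\<dots> = real p ^ m * (real p ^ (2 * h - m) + of_int s * real p ^ h
           - of_int s * (real p ^ (h - m) * (real p * of_int k + 1)))"
  proof -
    have "real p ^ (2 * h) = real p ^ m * real p ^ (2 * h - m)" "real p ^ h = real p ^ m * real p ^ (h - m)"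
      by (simp_all add: l flip: power_add)
    then show ?thesis by (simp add: algebra_simps)
  qed
  finally show ?thesis using p0 by simp
qed

theorem theorem4p6:
  fixes p n m :: nat
    and F :: "'a :: finite_field \<Rightarrow> 'b :: finite_field"
    and \<epsilon> :: complex
    and r :: "'b \<Rightarrow> int"
  assumes "prime p"
    and "CARD('a) = p ^ n"
    and "CARD('b) = p ^ m"
    and "bent p n m F"
    and "\<epsilon> \<in> {1, -1, \<i>, -\<i>}"
    and "\<And>b. b \<noteq> 0 \<Longrightarrow>
           walsh p n m F b 0 = \<epsilon> * of_real (real p powr (real n / 2)) * zeta p powi r b"
  shows "even n \<and> m \<le> n div 2 \<and>
    (\<exists>k :: 'b \<Rightarrow> int.
      (\<forall>a. 0 \<le> k a \<and> real_of_int (k a) \<le> (real p ^ m - 1) / (real p - 1) \<and>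
        (\<epsilon> \<in> {1, \<i>} \<longrightarrow>
          real (card (F -` {a})) =
            real p ^ (n - m) + real p ^ (n div 2)
              - real p ^ (n div 2 - m) * (real p * real_of_int (k a) + 1) \<and>
          real (card (F -` {a})) \<ge>
            real p ^ (n - m) - (real p ^ m - 1) / (real p - 1) * real p ^ (n div 2 - m)) \<and>
        (\<epsilon> \<in> {-1, -\<i>} \<longrightarrow>
          real (card (F -` {a})) =
            real p ^ (n - m) - real p ^ (n div 2)
              + real p ^ (n div 2 - m) * (real p * real_of_int (k a) + 1) \<and>
          real (card (F -` {a})) \<le>
            real p ^ (n - m) + (real p ^ m - 1) / (real p - 1) * real p ^ (n div 2 - m))) \<and>
      k 0 = int (card {b. b \<noteq> 0 \<and>
        walsh p n m F b 0 = of_real (real p powr (real n / 2)) * \<epsilon> * zeta p}))"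
proof -
  note p = assms(1) and card_a = assms(2) and card_b = assms(3) and walsh = assms(6)
  have p1: "p > 1" using p by (rule prime_gt_1_nat)
  have "even n" and eps: "\<epsilon> \<in> {1, -1}"
    using walsh_0_even_exponent[OF p card_a card_b assms(5) walsh] by auto
  then obtain h where n: "n = 2 * h" by (elim evenE)
  have root: "real p powr (real n / 2) = real p ^ h"
    using p1 by (simp add: n powr_realpow)
  obtain s :: int where s: "s \<in> {1, -1}" "\<epsilon> = of_int s" and s1: "\<epsilon> = 1 \<longleftrightarrow> s = 1"
    using eps by (metis insertI1 insertI2 insertE singletonD of_int_1 of_int_minus one_neq_neg_one)
  \<comment> \<open>A field has at least two elements, which excludes \<open>n = 0\<close>.\<close>
  have "card {0, 1 :: 'a} \<le> CARD('a)" by (rule card_mono) auto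
  then have h: "h > 0" using card_a n by (intro Nat.gr0I) simp
  have walsh': "walsh p (2 * h) m F b 0 = of_int (s * int p ^ h) * zeta p powi r b"
    if "b \<noteq> 0" for b
    using walsh[OF that] by (simp add: s(2) root n[symmetric])
  \<comment> \<open>At \<open>a = 0\<close> the trace term vanishes, so the residue 1 selects the
    \<open>b\<close> whose Walsh coefficient carries the factor \<open>zeta p\<close>
    itself.\<close>
  define k where "k a = int (card {b. b \<noteq> 0 \<and> [r b + abs_trace p m (- (a * b)) = 1] (mod int p)})" for a
  have count: "int p ^ m * int (card (F -` {a})) =
        int p ^ (2 * h) + s * int p ^ h * (int p ^ m - 1 - int p * k a)"
    and k_bound: "(int p - 1) * k a \<le> int p ^ m - 1" for a
    unfolding k_def
    using preimage_count[OF p card_a[unfolded n] card_b s(1), of F r a] walsh' by blast+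
  have mh: "m \<le> h" using exponent_bound[OF p h s(1) count] .
  have N: "real (card (F -` {a})) = real p ^ (n - m) + of_int s * real p ^ h
           - of_int s * (real p ^ (h - m) * (real p * of_int (k a) + 1))" for a
    using exact_count_over_reals[OF p mh count, of a] by (simp add: n)
  have k_le: "(real p - 1) * of_int (k a) \<le> real p ^ m - 1" for a
  proof -
    have "real_of_int ((int p - 1) * k a) \<le> of_int (int p ^ m - 1)"
      using k_bound[of a] by (simp only: of_int_le_iff)
    then show ?thesis by simp
  qed
  define K where "K = (real p ^ m - 1) / (real p - 1)"
  have K: "(real p - 1) * K = real p ^ m - 1" using p1 by (simp add: K_def)
  have kK: "of_int (k a) \<le> K" for a
    using k_le[of a] p1 unfolding K[symmetric] by simp
  \<comment> \<open>From \<open>(p - 1) * K = p ^ m - 1\<close> one gets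
    \<open>p * K + 1 = p ^ m + K\<close>; multiplied by \<open>p ^ (h - m)\<close>, its first term
    cancels the middle term \<open>p ^ h\<close> of the count.\<close>
  have bound: "real p ^ (h - m) * (real p * of_int (k a) + 1) \<le> real p ^ h + K * real p ^ (h - m)" for a
  proof -
    have "real p * of_int (k a) + 1 \<le> real p * K + 1"
      using kK[of a] by (simp add: mult_left_mono)
    also have "\<dots> = real p ^ m + K" using K by (simp add: algebra_simps)
    finally have "real p ^ (h - m) * (real p * of_int (k a) + 1) \<le> real p ^ (h - m) * (real p ^ m + K)"
      by (simp add: mult_left_mono)
    also have "\<dots> = real p ^ h + K * real p ^ (h - m)"
      using mh by (simp add: ring_distribs mult.commute flip: power_add)
    finally show ?thesis .
  qed
  have "k 0 = int (card {b. b \<noteq> 0 \<and>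
        walsh p n m F b 0 = of_real (real p powr (real n / 2)) * \<epsilon> * zeta p})"
  proof -
    have "[r b + abs_trace p m (- (0 * b)) = 1] (mod int p) \<longleftrightarrow>
        walsh p n m F b 0 = of_real (real p powr (real n / 2)) * \<epsilon> * zeta p"
      if "b \<noteq> 0" for b
    proof -
      have "\<epsilon> * of_real (real p powr (real n / 2)) \<noteq> 0" using eps p1 by auto
      then have "walsh p n m F b 0 = of_real (real p powr (real n / 2)) * \<epsilon> * zeta p \<longleftrightarrow>
          zeta p powi r b = zeta p powi 1"
        unfolding walsh[OF that] by (auto simp: mult_ac)
      then show ?thesis
        using zeta_powi_eq_iff[OF prime_gt_0_nat[OF p], of "r b" 1]
        by (simp add: abs_trace_0[OF p card_b])
    qed
    then show ?thesis unfolding k_def by (metis (no_types, lifting))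
  qed
  moreover have "real (card (F -` {a})) \<ge> real p ^ (n - m) - K * real p ^ (h - m)" if "s = 1" for a
    using N[of a] bound[of a] that by simp
  moreover have "real (card (F -` {a})) \<le> real p ^ (n - m) + K * real p ^ (h - m)" if "s = -1" for a
    using N[of a] bound[of a] that by simp
  moreover have "0 \<le> k a" for a by (simp add: k_def)
  \<comment> \<open>The imaginary values are excluded, so the two cases of the claim become
    \<open>s = 1\<close> and \<open>s = -1\<close>.\<close>
  moreover have "\<epsilon> \<noteq> \<i>" "\<epsilon> \<noteq> -\<i>" using eps by (auto simp: complex_eq_iff)
  moreover have "n div 2 = h" using n by simp
  moreover have "\<epsilon> = -1 \<longleftrightarrow> s = -1" using s s1 by auto
  ultimately show ?thesis
    using \<open>even n\<close> mh kK N s1 unfolding K_def[symmetric]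
    by (intro conjI exI[of _ k] allI) auto
qed

end
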